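(* Let $\lambda$, $\mu$, $v$ and $u$ be strictly positive integers and let $m>2$ be an integer. If there exists an $m$-cycle decomposition of $(\lambda+\mu)K_{v+u}-\lambda K_v$, then (a) $u(\lambda+\mu)+\mu(v-1)\equiv 0\pmod{2}$; (b) $v(\lambda+\mu)+(\lambda+\mu)(u-1)\equiv 0\pmod{2}$; (c) $(\lambda+\mu)\binom{u}{2}+vu(\lambda+\mu)+\mu\binom{v}{2}\equiv 0\pmod{m}$; (d) if $u<m$ then $$\left\lfloor \frac{(\lambda+\mu)\binom{u}{2}}{u-1}\right\rfloor (m-u+1)+\varepsilon_1\left(m-\frac{u-1}{2}\right)\leq \mu\binom{v}{2}+vu(\lambda+\mu),$$ where $\varepsilon_1=0$ if $u(\lambda+\mu)\equiv 0\pmod 2$ and $\varepsilon_1=1$ if $u(\lambda+\mu)\equiv 1\pmod 2$; (e) if $v<m$ then $$\left\lfloor \frac{\mu\binom{v}{2}}{v-1}\right\rfloor (m-v+1)+\varepsilon_2\left(m-\frac{v-1}{2}\right)\leq (\lambda+\mu)\binom{u}{2}+vu(\lambda+\mu),$$ where $\varepsilon_2=0$ if $\mu v\equiv 0\pmod 2$ and $\varepsilon_2=1$ if $\mu v\equiv 1\pmod 2$.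
   Context: All multigraphs are loopless. $\lambda K_n$ denotes the complete multigraph on $n$ vertices with exactly $\lambda$ parallel edges between each pair of distinct vertices. If $G_2$ is a subgraph of $G_1$, then $G_1-G_2$ is $G_1$ with the edges of $G_2$ removed; thus $(\lambda+\mu)K_{v+u}-\lambda K_v$ is the multigraph on vertex set $V\cup U$ ($|V|=v$, $|U|=u$, disjoint) obtained from $(\lambda+\mu)K_{v+u}$ by deleting the edges of a copy of $\lambda K_v$ on $V$ (so pairs inside $V$ have multiplicity $\mu$, all other pairs multiplicity $\lambda+\mu$). An $m$-cycle decomposition of a multigraph $G$ is a partition of its edge set into (edge sets of) cycles of length $m$. *)

theory Defs
  imports Complex_Main "HOL-Library.Multiset" "HOL-Number_Theory.Cong"
begin

text \<open>
  A loopless multigraph is represented by its multiset of edges, an edge being the two-element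
  set of its ends and parallel edges being repeated occurrences.  The vertex set is kept
  separately; it does not matter for cycle decompositions, which only concern edges.
\<close>

type_synonym 'a edges = "'a set multiset"

definition complete_multigraph :: "nat \<Rightarrow> 'a set \<Rightarrow> 'a edges" where
  "complete_multigraph l W = repeat_mset l (mset_set {e. e \<subseteq> W \<and> card e = 2})"

definition cycle_edges :: "'a list \<Rightarrow> 'a edges" where
  "cycle_edges xs =
     mset (map (\<lambda>i. {xs ! i, xs ! (Suc i mod length xs)}) [0..<length xs])"

definition is_cycle :: "nat \<Rightarrow> 'a edges \<Rightarrow> bool" where
  "is_cycle m C \<longleftrightarrow> (\<exists>xs. length xs = m \<and> distinct xs \<and> C = cycle_edges xs)"

text \<open>
  A partition of the edges of a multigraph is a multiset of parts summing to the edge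
  multiset: the same vertex cycle may occur several times, on different parallel edges.
\<close>

definition cycle_decomposition :: "nat \<Rightarrow> 'a edges \<Rightarrow> 'a edges multiset \<Rightarrow> bool" where
  "cycle_decomposition m G \<D> \<longleftrightarrow> (\<forall>C \<in># \<D>. is_cycle m C) \<and> \<Sum>\<^sub># \<D> = G"

end

theory Submission
  imports Defs
begin

text \<open>
  A cycle meets each vertex in an even number of edges, which gives (a) and (b).
  A cycle of length \<open>m\<close> has at most \<open>w - 1\<close> edges inside a nonempty set \<open>W\<close> of \<open>w < m\<close> vertices,
  since these edges form a linear forest.  If \<open>n\<close> cycles cover the \<open>l w (w - 1) / 2\<close> edges
  inside \<open>W\<close>, then \<open>n \<ge> \<lceil>l w / 2\<rceil>\<close>, and the number of remaining edges is
  \<open>n m - l w (w - 1) / 2\<close>; this is (d) for \<open>W = U\<close> and (e) for \<open>W = V\<close>.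
\<close>

section \<open>Edge counts in a single cycle\<close>

lemma size_cycle_edges [simp]: "size (cycle_edges xs) = length xs"
  by (simp add: cycle_edges_def)

text \<open>Counting positions instead of edges respects multiplicity: a list of length 2 yields the
  same pair from both of its positions.\<close>

lemma size_filter_cycle_edges:
  "size (filter_mset P (cycle_edges xs)) =
     card {i. i < length xs \<and> P {xs ! i, xs ! (Suc i mod length xs)}}"
proof -
  have "size (filter_mset P (cycle_edges xs)) =
      length (filter P (map (\<lambda>i. {xs ! i, xs ! (Suc i mod length xs)}) [0..<length xs]))"
    unfolding cycle_edges_def mset_filter[symmetric] size_mset ..
  also have "\<dots> = length (filter (\<lambda>i. P {xs ! i, xs ! (Suc i mod length xs)}) [0..<length xs])"
    by (simp add: filter_map comp_def)
  also have "\<dots> = card {i. i < length xs \<and> P {xs ! i, xs ! (Suc i mod length xs)}}"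
    unfolding length_filter_conv_card by (intro arg_cong[where f = card]) auto
  finally show ?thesis .
qed

lemma bij_betw_Suc_mod:
  assumes "n > 0"
  shows "bij_betw (\<lambda>i. Suc i mod n) {..<n} {..<n}"
proof -
  have "inj_on (\<lambda>i. Suc i mod n) {..<n}"
    by (auto simp: inj_on_def mod_Suc split: if_splits)
  moreover have "(\<lambda>i. Suc i mod n) ` {..<n} \<subseteq> {..<n}"
    using assms by auto
  ultimately show ?thesis
    by (simp add: bij_betw_def endo_inj_surj)
qed

text \<open>The edges at \<open>x\<close> are those whose first end is \<open>x\<close> (positions
  \<open>?A\<close>) and those whose second end is \<open>x\<close> (positions \<open>?B\<close>);
  cyclic succession maps \<open>?B\<close> bijectively onto \<open>?A\<close>. Length 1 is excluded
  because its only edge would be a singleton, counted once.\<close>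

lemma even_degree_cycle_edges:
  assumes "distinct xs" and "length xs \<noteq> 1"
  shows "even (size (filter_mset (\<lambda>e. x \<in> e) (cycle_edges xs)))"
proof (cases "xs = []")
  case True
  then show ?thesis by (simp add: cycle_edges_def)
next
  case False
  define n where "n = length xs"
  have n: "n > 1"
    using False assms(2) unfolding n_def by (cases xs) auto
  let ?A = "{i. i < n \<and> xs ! i = x}" and ?B = "{i. i < n \<and> xs ! (Suc i mod n) = x}"
  have bij: "bij_betw (\<lambda>i. Suc i mod n) {..<n} {..<n}"
    using n by (intro bij_betw_Suc_mod) simp
  have "(\<lambda>i. Suc i mod n) ` ?B = ?A"
  proof (intro equalityI subsetI)
    fix j assume j: "j \<in> ?A"
    then obtain i where "i < n" "j = Suc i mod n"
      using bij_betw_imp_surj_on[OF bij] by blast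
    with j show "j \<in> (\<lambda>i. Suc i mod n) ` ?B"
      by blast
  qed (use n in auto)
  then have "bij_betw (\<lambda>i. Suc i mod n) ?B ?A"
    by (rule bij_betw_subset[OF bij, rotated]) auto
  then have card: "card ?B = card ?A"
    by (rule bij_betw_same_card)
  \<comment> \<open>A common position would equal its own cyclic successor, which is impossible for
    \<open>n > 1\<close>.\<close>
  have disjoint: "?A \<inter> ?B = {}"
  proof (rule equals0I)
    fix i assume "i \<in> ?A \<inter> ?B"
    then have i: "i < n" "xs ! i = xs ! (Suc i mod n)"
      by auto
    have "Suc i mod n < n"
      using n by simp
    with i have "i = Suc i mod n"
      using nth_eq_iff_index_eq[OF assms(1), of i "Suc i mod n"] unfolding n_def by blast
    then show False
      using i(1) n by (auto simp: mod_Suc split: if_splits)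
  qed
  have "{i. i < n \<and> x \<in> {xs ! i, xs ! (Suc i mod n)}} = ?A \<union> ?B"
    by auto
  also have "card \<dots> = card ?A + card ?B"
    using disjoint by (intro card_Un_disjoint) simp_all
  finally have "card {i. i < n \<and> x \<in> {xs ! i, xs ! (Suc i mod n)}} = 2 * card ?A"
    unfolding card by simp
  then show ?thesis
    by (simp add: size_filter_cycle_edges n_def)
qed

text \<open>An edge inside \<open>W\<close> starts in \<open>W\<close>, so \<open>?B\<close> is a
  subset of \<open>?A\<close>, which has at most \<open>card W\<close> elements. If the bound
  failed, the two sets would coincide, \<open>?A\<close> would be closed under cyclic succession,
  and the whole cycle would lie in \<open>W\<close>.\<close>

lemma cycle_edges_within_less:
  assumes "distinct xs" and "finite W" and "W \<noteq> {}" and "card W < length xs"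
  shows "size (filter_mset (\<lambda>e. e \<subseteq> W) (cycle_edges xs)) < card W"
proof (rule ccontr)
  define n where "n = length xs"
  let ?A = "{i. i < n \<and> xs ! i \<in> W}" and ?B = "{i. i < n \<and> {xs ! i, xs ! (Suc i mod n)} \<subseteq> W}"
  assume "\<not> ?thesis"
  then have B: "card W \<le> card ?B"
    by (simp add: size_filter_cycle_edges n_def)
  have "inj_on ((!) xs) ?A"
    using assms(1) by (auto simp: inj_on_def n_def nth_eq_iff_index_eq)
  then have A: "card ?A \<le> card W"
    by (rule card_inj_on_le) (use assms(2) in auto)
  have "?B = ?A"
    by (rule card_seteq) (use A B in auto)
  have step: "Suc i mod n \<in> ?A" if "i \<in> ?A" for i
  proof -
    from that have "i \<in> ?B"
      by (simp only: \<open>?B = ?A\<close>)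
    then show ?thesis
      by simp
  qed
  have "card W > 0"
    using assms(2,3) by (simp add: card_gt_0_iff)
  with A B \<open>?B = ?A\<close> have "card ?A > 0"
    by simp
  then obtain i where i: "i \<in> ?A"
    by (auto simp: card_gt_0_iff)
  have iter: "(i + k) mod n \<in> ?A" for k
  proof (induction k)
    case (Suc k)
    from step[OF this] show ?case by (simp add: mod_Suc_eq)
  qed (use i in simp)
  \<comment> \<open>The shift \<open>n - i + j\<close> takes \<open>i\<close> to
    \<open>n + j\<close>, which is \<open>j\<close> modulo \<open>n\<close>.\<close>
  have "j \<in> ?A" if "j < n" for j
    using iter[of "n - i + j"] i that by simp
  then have "?A = {..<n}"
    by auto
  then have "n \<le> card W"
    using A by simp
  then show False
    using assms(4) by (simp add: n_def)
qed

section \<open>Summation over the cycles of a decomposition\<close>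

lemma size_filter_sum_mset:
  "size (filter_mset P (\<Sum>\<^sub># \<D>)) = (\<Sum>C\<in>#\<D>. size (filter_mset P C))"
  by (induction \<D>) auto

lemma cycle_decomposition_size:
  assumes "cycle_decomposition m G \<D>"
  shows "size G = size \<D> * m"
proof -
  have "\<forall>C\<in>#\<D>. size C = m" and G: "G = \<Sum>\<^sub># \<D>"
    using assms by (auto simp: cycle_decomposition_def is_cycle_def)
  from this(1) show ?thesis
    unfolding G by (induction \<D>) auto
qed

lemma cycle_decomposition_even_degree:
  assumes "cycle_decomposition m G \<D>" and "m \<noteq> 1"
  shows "even (size (filter_mset (\<lambda>e. x \<in> e) G))"
proof -
  have "\<forall>C\<in>#\<D>. even (size (filter_mset (\<lambda>e. x \<in> e) C))" and G: "G = \<Sum>\<^sub># \<D>"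
    using assms by (auto simp: cycle_decomposition_def is_cycle_def even_degree_cycle_edges)
  from this(1) show ?thesis
    unfolding G size_filter_sum_mset by (induction \<D>) auto
qed

lemma cycle_decomposition_within_le:
  assumes "cycle_decomposition m G \<D>" and "finite W" and "W \<noteq> {}" and "card W < m"
  shows "size (filter_mset (\<lambda>e. e \<subseteq> W) G) \<le> size \<D> * (card W - 1)"
proof -
  have "size (filter_mset (\<lambda>e. e \<subseteq> W) C) \<le> card W - 1" if "C \<in># \<D>" for C
  proof -
    have "is_cycle m C"
      using assms(1) that by (simp add: cycle_decomposition_def)
    then obtain xs where "length xs = m" "distinct xs" "C = cycle_edges xs"
      unfolding is_cycle_def by blast
    then show ?thesis
      using cycle_edges_within_less[of xs W] assms(2-4) by simp
  qed
  then have "\<forall>C\<in>#\<D>. size (filter_mset (\<lambda>e. e \<subseteq> W) C) \<le> card W - 1"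
    by blast
  then have "(\<Sum>C\<in>#\<D>. size (filter_mset (\<lambda>e. e \<subseteq> W) C)) \<le> size \<D> * (card W - 1)"
    by (induction \<D>) (simp_all add: add_mono)
  then show ?thesis
    using assms(1) by (simp add: cycle_decomposition_def flip: size_filter_sum_mset)
qed

section \<open>Edge counts in complete multigraphs and their differences\<close>

lemma size_filter_complete_multigraph:
  assumes "finite W"
  shows "size (filter_mset P (complete_multigraph l W)) = l * card {e. e \<subseteq> W \<and> card e = 2 \<and> P e}"
proof -
  have "size (filter_mset P (repeat_mset l M)) = l * size (filter_mset P M)" for M :: "'a edges"
    by (induction l) auto
  moreover have "{e \<in> {e. e \<subseteq> W \<and> card e = 2}. P e} = {e. e \<subseteq> W \<and> card e = 2 \<and> P e}"
    by auto
  ultimately show ?thesis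
    using assms by (simp add: complete_multigraph_def)
qed

text \<open>Multiset difference truncates at zero; this inclusion ensures that the size of the
  difference is the difference of the sizes.\<close>

lemma complete_multigraph_mono:
  assumes "k \<le> l" and "W \<subseteq> X" and "finite X"
  shows "complete_multigraph k W \<subseteq># complete_multigraph l X"
proof (rule mset_subset_eqI)
  fix e
  have "finite W"
    using assms finite_subset by blast
  then show "count (complete_multigraph k W) e \<le> count (complete_multigraph l X) e"
    using assms by (auto simp: complete_multigraph_def count_mset_set')
qed

text \<open>Keeping \<open>P\<close> general lets one formula give the total size, the degrees and
  the numbers of edges inside \<open>U\<close> and inside \<open>V\<close>.\<close>

lemma size_filter_complete_multigraph_diff:
  assumes "k \<le> l" and "W \<subseteq> X" and "finite X"
  shows "size (filter_mset P (complete_multigraph l X - complete_multigraph k W)) =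
    l * card {e. e \<subseteq> X \<and> card e = 2 \<and> P e} - k * card {e. e \<subseteq> W \<and> card e = 2 \<and> P e}"
proof -
  have "finite W"
    using assms finite_subset by blast
  then show ?thesis
    using complete_multigraph_mono[OF assms] assms(3)
    by (simp add: filter_diff_mset size_Diff_submset multiset_filter_mono
        size_filter_complete_multigraph)
qed

lemma card_pairs_containing:
  assumes "finite W" and "x \<in> W"
  shows "card {e. e \<subseteq> W \<and> card e = 2 \<and> x \<in> e} = card W - 1"
proof -
  have "{e. e \<subseteq> W \<and> card e = 2 \<and> x \<in> e} = (\<lambda>y. {x, y}) ` (W - {x})"
    using assms(2) by (auto simp: card_2_iff)
  moreover have "inj_on (\<lambda>y. {x, y}) (W - {x})"
    by (auto simp: inj_on_def doubleton_eq_iff)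
  ultimately show ?thesis
    using assms by (simp add: card_image)
qed

section \<open>Arithmetic of binomials and floors\<close>

lemma add_choose_two: "(a + b) choose 2 = (a choose 2) + (b choose 2) + a * b" for a b :: nat
  by (induction b) (simp_all add: numeral_2_eq_2)

text \<open>For \<open>w = 1\<close> the quotient has denominator \<open>0\<close> and its value is \<open>0\<close>.\<close>

lemma outside_edges_bound:
  fixes l w m n R :: nat
  assumes "n > 0" and "w > 0"
    and "l * (w choose 2) \<le> n * (w - 1)" and "n * m = l * (w choose 2) + R" and "w < m"
  shows "real_of_int \<lfloor>real (l * (w choose 2)) / (real w - 1)\<rfloor> * (real m - real w + 1)
      + (if even (l * w) then 0 else 1) * (real m - (real w - 1) / 2) \<le> real R"
proof (cases "w = 1")
  \<comment> \<open>Here \<open>w choose 2\<close> is 0, so \<open>R = n * m\<close>, while the left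
    side is at most \<open>m\<close>.\<close>
  case True
  moreover have "m \<le> n * m"
    using assms(1) by simp
  ultimately show ?thesis
    using assms(4) by (simp add: numeral_2_eq_2)
next
  case False
  then have w: "real w - 1 > 0"
    using assms(2) by simp
  have pred: "real (w - 1) = real w - 1"
    using assms(2) by (simp add: of_nat_diff)
  have choose: "real (l * (w choose 2)) = real (l * w) / 2 * (real w - 1)"
  proof -
    have "even (w * (w - 1))"
      by (cases w) auto
    then have "2 * (w choose 2) = w * (w - 1)"
      unfolding choose_two by (rule dvd_mult_div_cancel)
    then have "real (2 * (w choose 2)) = real (w * (w - 1))"
      by (simp only:)
    then have "2 * real (w choose 2) = real w * (real w - 1)"
      unfolding of_nat_mult pred by simp
    then have "real (w choose 2) = real w / 2 * (real w - 1)"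
      by simp
    then show ?thesis
      unfolding of_nat_mult by simp
  qed
  then have quot: "real (l * (w choose 2)) / (real w - 1) = real (l * w) / 2"
    unfolding choose by (intro nonzero_mult_div_cancel_right) (use w in simp)
  have R: "real R = real n * real m - real (l * (w choose 2))"
    using arg_cong[OF assms(4), of real] unfolding of_nat_add of_nat_mult by simp
  have "real (l * (w choose 2)) \<le> real n * (real w - 1)"
    using assms(3) unfolding pred[symmetric] of_nat_mult[symmetric] of_nat_le_iff .
  \<comment> \<open>Cancelling \<open>w - 1\<close> gives \<open>n\<close> at least
    \<open>l * w / 2\<close>; integrality of \<open>n\<close> supplies the rounding up in the odd
    case.\<close>
  then have half: "real (l * w) / 2 \<le> real n"
    unfolding choose using w by (simp only: mult_le_cancel_right_pos)
  have n: "l * w \<le> 2 * n"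
  proof -
    have "real (l * w) \<le> real (2 * n)"
      using half by simp
    then show ?thesis
      by (simp only: of_nat_le_iff)
  qed
  show ?thesis
  proof (cases "even (l * w)")
    \<comment> \<open>With \<open>l * w = 2 * k\<close> the left side equals
      \<open>k * m - l * (w choose 2)\<close>, so only \<open>k \<le> n\<close> is needed.\<close>
    case True
    then obtain k where k: "l * w = 2 * k" ..
    then have "real k * real m \<le> real n * real m"
      using n by (intro mult_right_mono) auto
    then show ?thesis
      unfolding quot unfolding R choose k by (simp add: algebra_simps)
  next
    \<comment> \<open>With \<open>l * w = 2 * k + 1\<close> the floor is \<open>k\<close>, and the
      extra summand raises the left side to exactly
      \<open>(k + 1) * m - l * (w choose 2)\<close>.\<close>
    case False
    then obtain k where k: "l * w = 2 * k + 1" ..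
    then have "k + 1 \<le> n"
      using n by simp
    then have "real (k + 1) * real m \<le> real n * real m"
      by (intro mult_right_mono) (auto simp del: of_nat_add)
    moreover have "\<lfloor>real (2 * k + 1) / 2\<rfloor> = int k"
      by (rule floor_unique) auto
    ultimately show ?thesis
      unfolding quot unfolding R choose k by (simp add: field_simps)
  qed
qed

theorem theorem2p1:
  fixes lam \<mu> v u m :: nat and V U :: "'a set"
  assumes "lam > 0" and "\<mu> > 0" and "v > 0" and "u > 0" and "m > 2"
    and "finite V" and "card V = v" and "finite U" and "card U = u" and "V \<inter> U = {}"
    and "\<exists>\<D>. cycle_decomposition m
           (complete_multigraph (lam + \<mu>) (V \<union> U) - complete_multigraph lam V) \<D>"
  shows "[u * (lam + \<mu>) + \<mu> * (v - 1) = 0] (mod 2)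
    \<and> [v * (lam + \<mu>) + (lam + \<mu>) * (u - 1) = 0] (mod 2)
    \<and> [(lam + \<mu>) * (u choose 2) + v * u * (lam + \<mu>) + \<mu> * (v choose 2) = 0] (mod m)
    \<and> (u < m \<longrightarrow>
        (let \<epsilon>\<^sub>1 = (if [u * (lam + \<mu>) = 0] (mod 2) then 0 else 1 :: real) in
          real_of_int \<lfloor>real ((lam + \<mu>) * (u choose 2)) / (real u - 1)\<rfloor> * (real m - real u + 1)
            + \<epsilon>\<^sub>1 * (real m - (real u - 1) / 2)
          \<le> real (\<mu> * (v choose 2) + v * u * (lam + \<mu>))))
    \<and> (v < m \<longrightarrow>
        (let \<epsilon>\<^sub>2 = (if [\<mu> * v = 0] (mod 2) then 0 else 1 :: real) in
          real_of_int \<lfloor>real (\<mu> * (v choose 2)) / (real v - 1)\<rfloor> * (real m - real v + 1)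
            + \<epsilon>\<^sub>2 * (real m - (real v - 1) / 2)
          \<le> real ((lam + \<mu>) * (u choose 2) + v * u * (lam + \<mu>))))"
proof -
  define G where "G = complete_multigraph (lam + \<mu>) (V \<union> U) - complete_multigraph lam V"
  obtain \<D> where D: "cycle_decomposition m G \<D>"
    using assms(11) unfolding G_def by blast
  have fin: "finite (V \<union> U)" and card_Un: "card (V \<union> U) = v + u"
    using assms by (simp_all add: card_Un_disjoint)
  have count: "size (filter_mset P G) = (lam + \<mu>) * card {e. e \<subseteq> V \<union> U \<and> card e = 2 \<and> P e}
      - lam * card {e. e \<subseteq> V \<and> card e = 2 \<and> P e}" for P
    unfolding G_def by (rule size_filter_complete_multigraph_diff) (use fin in auto)
  have size: "size G = (lam + \<mu>) * (u choose 2) + v * u * (lam + \<mu>) + \<mu> * (v choose 2)"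
    using count[of "\<lambda>_. True"] fin assms(6,7) card_Un
    by (simp add: n_subsets add_choose_two algebra_simps)

  \<comment> \<open>Condition (a) is the parity of the degree of a vertex of
    \<open>V\<close>.\<close>
  obtain x where x: "x \<in> V"
    using assms(3,7) by fastforce
  have "size (filter_mset (\<lambda>e. x \<in> e) G) = (lam + \<mu>) * (v + u - 1) - lam * (v - 1)"
    using count[of "\<lambda>e. x \<in> e"] x fin card_Un assms(6,7) by (simp add: card_pairs_containing)
  also have "\<dots> = u * (lam + \<mu>) + \<mu> * (v - 1)"
    using assms(3) by (cases v) (simp_all add: algebra_simps)
  finally have a: "even (u * (lam + \<mu>) + \<mu> * (v - 1))"
    using cycle_decomposition_even_degree[OF D, of x] assms(5) by simp

  \<comment> \<open>Condition (b) is the parity of the degree of a vertex of \<open>U\<close>, which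
    meets no deleted edge.\<close>
  obtain y where y: "y \<in> U"
    using assms(4,9) by fastforce
  then have none: "{e. e \<subseteq> V \<and> card e = 2 \<and> y \<in> e} = {}"
    using assms(10) by auto
  have "size (filter_mset (\<lambda>e. y \<in> e) G) = (lam + \<mu>) * (v + u - 1)"
    unfolding count none using y fin card_Un by (simp add: card_pairs_containing)
  also have "\<dots> = v * (lam + \<mu>) + (lam + \<mu>) * (u - 1)"
    using assms(4) by (cases u) (simp_all add: algebra_simps)
  finally have b: "even (v * (lam + \<mu>) + (lam + \<mu>) * (u - 1))"
    using cycle_decomposition_even_degree[OF D, of y] assms(5) by simp

  have c: "m dvd (lam + \<mu>) * (u choose 2) + v * u * (lam + \<mu>) + \<mu> * (v choose 2)"
    using cycle_decomposition_size[OF D] size by simp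

  \<comment> \<open>The edges between \<open>V\<close> and \<open>U\<close> force at least one
    cycle. This matters for (d) and (e) when the set has a single vertex, since the count of inner
    edges then says nothing about the number of cycles.\<close>
  have "size G > 0"
    unfolding size using assms(1,3,4) by simp
  then have n: "size \<D> > 0"
    using cycle_decomposition_size[OF D] by simp

  \<comment> \<open>No deleted edge lies in \<open>U\<close>, so pairs there keep multiplicity
    \<open>lam + \<mu>\<close>.\<close>
  have "{e. e \<subseteq> V \<union> U \<and> card e = 2 \<and> e \<subseteq> U} = {e. e \<subseteq> U \<and> card e = 2}"
    by auto
  moreover have "{e. e \<subseteq> V \<and> card e = 2 \<and> e \<subseteq> U} = {}"
    using assms(10) by (auto simp: card_2_iff)
  ultimately have "size (filter_mset (\<lambda>e. e \<subseteq> U) G) = (lam + \<mu>) * (u choose 2)"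
    using assms(8,9) by (simp only: count card.empty n_subsets)
  then have "(lam + \<mu>) * (u choose 2) \<le> size \<D> * (u - 1)" if "u < m"
    using cycle_decomposition_within_le[OF D, of U] that y assms(8,9) by auto
  moreover have
    "size \<D> * m = (lam + \<mu>) * (u choose 2) + (\<mu> * (v choose 2) + v * u * (lam + \<mu>))"
    using cycle_decomposition_size[OF D] size by simp
  ultimately have d: "real_of_int \<lfloor>real ((lam + \<mu>) * (u choose 2)) / (real u - 1)\<rfloor>
        * (real m - real u + 1)
      + (if even ((lam + \<mu>) * u) then 0 else 1) * (real m - (real u - 1) / 2)
      \<le> real (\<mu> * (v choose 2) + v * u * (lam + \<mu>))" if "u < m"
    using outside_edges_bound[OF n assms(4)] that by blast

  \<comment> \<open>Inside \<open>V\<close> both terms of \<open>count\<close> range over the same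
    pairs, which leaves multiplicity \<open>\<mu>\<close>.\<close>
  have "{e. e \<subseteq> V \<union> U \<and> card e = 2 \<and> e \<subseteq> V} = {e. e \<subseteq> V \<and> card e = 2}"
    and "{e. e \<subseteq> V \<and> card e = 2 \<and> e \<subseteq> V} = {e. e \<subseteq> V \<and> card e = 2}"
    by auto
  then have "size (filter_mset (\<lambda>e. e \<subseteq> V) G) = \<mu> * (v choose 2)"
    unfolding count using assms(6,7) by (simp add: n_subsets algebra_simps)
  then have "\<mu> * (v choose 2) \<le> size \<D> * (v - 1)" if "v < m"
    using cycle_decomposition_within_le[OF D, of V] that x assms(6,7) by auto
  moreover have
    "size \<D> * m = \<mu> * (v choose 2) + ((lam + \<mu>) * (u choose 2) + v * u * (lam + \<mu>))"
    using cycle_decomposition_size[OF D] size by simp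
  ultimately have e: "real_of_int \<lfloor>real (\<mu> * (v choose 2)) / (real v - 1)\<rfloor>
        * (real m - real v + 1)
      + (if even (\<mu> * v) then 0 else 1) * (real m - (real v - 1) / 2)
      \<le> real ((lam + \<mu>) * (u choose 2) + v * u * (lam + \<mu>))" if "v < m"
    using outside_edges_bound[OF n assms(3)] that by blast

  show ?thesis
    unfolding Let_def cong_0_iff mult.commute[of u "lam + \<mu>"]
    using a b c d e by (simp only: mult.commute[of u "lam + \<mu>"]) simp
qed

end
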